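(* Let $\phi\in C^6([0,T])$, $\lambda<0$, $\Delta t>0$, $z=\lambda\Delta t$, $t_{n+1}=t_n+\Delta t$ with $[t_n,t_{n+1}]\subset[0,T]$, and let $C\in[C_-,C_+]$. If one step of the method is applied to $y'=\lambda(y-\phi(t))+\phi'(t)$ from the exact starting value $y^n=\phi(t_n)$, then $$y^{n+1}-\phi(t_{n+1})=-\phi^{(5)}(t_n)\,\Delta t^5\,Q_C(z)+\Delta t^6\,\mathcal E_C(z,t_n,\Delta t),$$ $$Q_C(z)=\frac{(69C-1)z^2+(16-960C)z+3600C-48}{480\,(z^2-12z+48)\,[9Cz^2-(39C+1)z+6]}.$$ For every $C\in[C_-,C_+]$ there is a constant $K_C$, independent of $z\le0$, $t_n$ and $\Delta t$, such that $$|\mathcal E_C(z,t_n,\Delta t)|\le K_C\max_{t\in[t_n,t_{n+1}]}|\phi^{(6)}(t)|.$$ Moreover, $$Q_C(z)=\frac{69C-1}{4320C}\,z^{-2}+O(z^{-3}),\qquad z\to-\infty.$$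
   Context: Set $C_\pm=\frac{25\pm\sqrt{105}}{780}$, $a_0=\frac16+\frac72C$, $a_1=\frac23-10C$, $a_2=\frac16+\frac{13}{2}C$. For the problem $y'=F(t,y):=\lambda(y-\phi(t))+\phi'(t)$, the derivative of $F$ along trajectories is $\dot F(t,y)=\lambda^2(y-\phi(t))+\phi''(t)$. With $t_{n+1/2}=t_n+\Delta t/2$, write $F_n=F(t_n,y^n)$, $F_\star=F(t_{n+1/2},y^\star)$, $F_{n+1}=F(t_{n+1},y^{n+1})$, and similarly $\dot F_n,\dot F_\star,\dot F_{n+1}$. One step of the method consists of the two (linear, scalar) implicit equations, solved exactly and successively for $y^\star$ and $y^{n+1}$: $$y^\star=y^n+\tfrac{\Delta t}{4}(F_n+F_\star)+\tfrac{\Delta t^2}{48}(\dot F_n-\dot F_\star),$$ $$y^{n+1}=y^n+\Delta t\,(a_0F_n+a_1F_\star+a_2F_{n+1})+C\Delta t^2\bigl(\dot F_n-\dot F_\star-\tfrac32\dot F_{n+1}\bigr).$$ *)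

theory Defs
  imports "HOL-Analysis.Analysis"
begin

text \<open>
  Derivatives are taken within the set, so on a compact interval they are one-sided
  at the endpoints.
\<close>

definition deriv_within :: "real set \<Rightarrow> nat \<Rightarrow> (real \<Rightarrow> real) \<Rightarrow> real \<Rightarrow> real" where
  "deriv_within S k f = ((\<lambda>g t. vector_derivative g (at t within S)) ^^ k) f"

definition Ck_on :: "nat \<Rightarrow> (real \<Rightarrow> real) \<Rightarrow> real set \<Rightarrow> bool" where
  "Ck_on k f S \<longleftrightarrow>
     (\<forall>i<k. deriv_within S i f differentiable_on S) \<and> continuous_on S (deriv_within S k f)"

definition C_minus :: real where "C_minus = (25 - sqrt 105) / 780"
definition C_plus :: real where "C_plus = (25 + sqrt 105) / 780"

definition a0 :: "real \<Rightarrow> real" where "a0 C = 1/6 + 7/2 * C"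
definition a1 :: "real \<Rightarrow> real" where "a1 C = 2/3 - 10 * C"
definition a2 :: "real \<Rightarrow> real" where "a2 C = 1/6 + 13/2 * C"

definition rhs :: "real set \<Rightarrow> real \<Rightarrow> (real \<Rightarrow> real) \<Rightarrow> real \<Rightarrow> real \<Rightarrow> real" where
  "rhs S l \<phi> t y = l * (y - \<phi> t) + deriv_within S 1 \<phi> t"

text \<open>The derivative of \<open>rhs\<close> along trajectories of \<open>y' = rhs S l \<phi> t y\<close>.\<close>

definition rhs_dot :: "real set \<Rightarrow> real \<Rightarrow> (real \<Rightarrow> real) \<Rightarrow> real \<Rightarrow> real \<Rightarrow> real" where
  "rhs_dot S l \<phi> t y = l\<^sup>2 * (y - \<phi> t) + deriv_within S 2 \<phi> t"

text \<open>
  \<open>is_step C F G dt t y0 ys y1\<close>: the stage value \<open>ys\<close> and the new value \<open>y1\<close> solve the two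
  implicit equations of one step of size \<open>dt\<close> started at \<open>(t, y0)\<close>; \<open>G\<close> is the derivative
  of \<open>F\<close> along trajectories.
\<close>

definition is_step ::
  "real \<Rightarrow> (real \<Rightarrow> real \<Rightarrow> real) \<Rightarrow> (real \<Rightarrow> real \<Rightarrow> real) \<Rightarrow>
     real \<Rightarrow> real \<Rightarrow> real \<Rightarrow> real \<Rightarrow> real \<Rightarrow> bool" where
  "is_step C F G dt t y0 ys y1 \<longleftrightarrow>
     ys = y0 + dt/4 * (F t y0 + F (t + dt/2) ys)
             + dt\<^sup>2/48 * (G t y0 - G (t + dt/2) ys) \<and>
     y1 = y0 + dt * (a0 C * F t y0 + a1 C * F (t + dt/2) ys + a2 C * F (t + dt) y1)
             + C * dt\<^sup>2 * (G t y0 - G (t + dt/2) ys - 3/2 * G (t + dt) y1)"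

definition Q :: "real \<Rightarrow> real \<Rightarrow> real" where
  "Q C z = ((69*C - 1) * z\<^sup>2 + (16 - 960*C) * z + 3600*C - 48) /
           (480 * (z\<^sup>2 - 12*z + 48) * (9*C*z\<^sup>2 - (39*C + 1) * z + 6))"

end

theory Submission
  imports Defs
begin

text \<open>
  Subtracting the exact solution turns the two implicit equations into triangular linear
  equations for the errors \<open>ys - \<phi> (t + dt/2)\<close> and \<open>y1 - \<phi> (t + dt)\<close>, whose right-hand
  sides are quadrature defects of \<open>\<phi>\<close>. Taylor's theorem shows that both defects are
  \<open>dt^5\<close> times a multiple of the fifth derivative, up to \<open>O(dt^6)\<close>. Elimination of the stage
  error gives \<open>Q\<close>; the remainder is uniform in \<open>z \<le> 0\<close> because there both denominators are
  bounded below and the stage error enters through a bounded rational function of \<open>z\<close>.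
\<close>

section \<open>Derivatives within a set and Taylor's formula\<close>

lemma deriv_within_0: "deriv_within S 0 f = f"
  by (simp add: deriv_within_def)

lemma Ck_on_has_real_derivative:
  assumes "Ck_on n f S" "k < n" "x \<in> S"
  shows "(deriv_within S k f has_real_derivative deriv_within S (Suc k) f x) (at x within S)"
proof -
  have "deriv_within S k f differentiable (at x within S)"
    using assms by (auto simp: Ck_on_def differentiable_on_def)
  then show ?thesis
    by (simp add: has_real_derivative_iff_has_vector_derivative deriv_within_def
        flip: vector_derivative_works)
qed

text \<open>Instance of \<open>field_Taylor\<close> on the convex set \<open>{a..b}\<close>, applied
  to the chain of derivatives from order \<open>k\<close> upwards; derivatives within
  \<open>S\<close> restrict to the subinterval. The bound carries \<open>fact n\<close> instead of
  the sharp \<open>fact (Suc n)\<close>, which is harmless since only the order of the remainder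
  matters.\<close>

lemma Ck_on_Taylor:
  assumes "Ck_on (Suc (k + n)) f S" "{a..b} \<subseteq> S" "x \<in> {a..b}"
    and B: "\<And>s. s \<in> {a..b} \<Longrightarrow> \<bar>deriv_within S (Suc (k + n)) f s\<bar> \<le> B"
  shows "\<bar>deriv_within S k f x - (\<Sum>i\<le>n. deriv_within S (k + i) f a * (x - a)^i / fact i)\<bar>
           \<le> B * (x - a)^Suc n / fact n"
proof -
  have "norm (deriv_within S (k + 0) f x -
          (\<Sum>i\<le>n. deriv_within S (k + i) f a * (x - a)^i / fact i))
        \<le> B * norm (x - a)^Suc n / fact n"
  proof (rule field_Taylor[where S = "{a..b}"])
    fix i s assume "s \<in> {a..b}" "i \<le> n"
    then have "(deriv_within S (k + i) f has_real_derivative deriv_within S (Suc (k + i)) f s)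
                 (at s within S)"
      using assms by (intro Ck_on_has_real_derivative) auto
    then show "(deriv_within S (k + i) f has_field_derivative deriv_within S (k + Suc i) f s)
                 (at s within {a..b})"
      using assms(2) by (auto intro: DERIV_subset)
  qed (use assms in auto)
  then show ?thesis
    using assms(3) by simp
qed

text \<open>Makes the supremum of the sixth derivative in the theorem a genuine upper bound: a
  continuous image of a compact interval is bounded.\<close>

lemma Ck_on_bdd_above:
  assumes "Ck_on n f S" "{a..b} \<subseteq> S"
  shows "bdd_above ((\<lambda>s. \<bar>deriv_within S n f s\<bar>) ` {a..b})"
proof -
  have "continuous_on {a..b} (deriv_within S n f)"
    using assms continuous_on_subset by (auto simp: Ck_on_def)
  then have "compact ((\<lambda>s. \<bar>deriv_within S n f s\<bar>) ` {a..b})"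
    by (intro compact_continuous_image continuous_intros) auto
  then show ?thesis
    by (simp add: bounded_imp_bdd_above compact_imp_bounded)
qed

section \<open>Denominators, defects and their remainders\<close>

lemma C_minus_pos: "C_minus > 0"
proof -
  have "sqrt 105 < sqrt (25\<^sup>2)"
    by (intro real_sqrt_less_mono) simp
  then show ?thesis
    by (simp add: C_minus_def)
qed

text \<open>48 times the coefficient \<open>1 - z/4 + z^2/48\<close> of the stage error in its error
  equation.\<close>

definition stage_den :: "real \<Rightarrow> real" where
  "stage_den z = z\<^sup>2 - 12*z + 48"

text \<open>6 times the coefficient \<open>1 - a2 C * z + 3/2 * C * z^2\<close> of the final error
  in its error equation.\<close>

definition step_den :: "real \<Rightarrow> real \<Rightarrow> real" where
  "step_den C z = 9*C*z\<^sup>2 - (39*C + 1)*z + 6"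

text \<open>Residual, right side minus left side, of the stage equation at the exact solution, where
  \<open>rhs\<close> and \<open>rhs_dot\<close> reduce to the first two derivatives of
  \<open>\<phi>\<close>. \<open>step_defect\<close> is the same for the second equation.\<close>

definition stage_defect :: "real set \<Rightarrow> (real \<Rightarrow> real) \<Rightarrow> real \<Rightarrow> real \<Rightarrow> real" where
  "stage_defect S \<phi> t dt = \<phi> t - \<phi> (t + dt/2)
     + dt/4 * (deriv_within S 1 \<phi> t + deriv_within S 1 \<phi> (t + dt/2))
     + dt\<^sup>2/48 * (deriv_within S 2 \<phi> t - deriv_within S 2 \<phi> (t + dt/2))"

definition step_defect :: "real \<Rightarrow> real set \<Rightarrow> (real \<Rightarrow> real) \<Rightarrow> real \<Rightarrow> real \<Rightarrow> real" where
  "step_defect C S \<phi> t dt = \<phi> t - \<phi> (t + dt)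
     + dt * (a0 C * deriv_within S 1 \<phi> t + a1 C * deriv_within S 1 \<phi> (t + dt/2)
             + a2 C * deriv_within S 1 \<phi> (t + dt))
     + C * dt\<^sup>2 * (deriv_within S 2 \<phi> t - deriv_within S 2 \<phi> (t + dt/2)
             - 3/2 * deriv_within S 2 \<phi> (t + dt))"

definition stage_rem :: "real set \<Rightarrow> (real \<Rightarrow> real) \<Rightarrow> real \<Rightarrow> real \<Rightarrow> real" where
  "stage_rem S \<phi> t dt = stage_defect S \<phi> t dt + deriv_within S 5 \<phi> t * dt^5 / 23040"

definition step_rem :: "real \<Rightarrow> real set \<Rightarrow> (real \<Rightarrow> real) \<Rightarrow> real \<Rightarrow> real \<Rightarrow> real" where
  "step_rem C S \<phi> t dt =
     step_defect C S \<phi> t dt - (1 - 75*C) / 2880 * deriv_within S 5 \<phi> t * dt^5"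

text \<open>The solved error equations with both defects replaced by their sixth-order remainders.
  It depends on the step only through \<open>z\<close>, \<open>t\<close> and \<open>dt\<close>, as
  the theorem demands.\<close>

definition error_rem :: "real \<Rightarrow> real set \<Rightarrow> (real \<Rightarrow> real) \<Rightarrow> real \<Rightarrow> real \<Rightarrow> real \<Rightarrow> real" where
  "error_rem C S \<phi> z t dt =
     6 / step_den C z * (48 * z * (a1 C - C*z) / stage_den z * stage_rem S \<phi> t dt
       + step_rem C S \<phi> t dt) / dt^6"

text \<open>For \<open>z \<le> 0\<close> all three summands are nonnegative, so the sum dominates
  each of them.\<close>

lemma stage_den_bounds:
  assumes "z \<le> 0"
  shows "48 \<le> stage_den z" "z\<^sup>2 \<le> stage_den z" "12 * \<bar>z\<bar> \<le> stage_den z"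
  using assms zero_le_power2[of z] unfolding stage_den_def by linarith+

lemma step_den_bounds:
  assumes "z \<le> 0" "C > 0"
  shows "6 \<le> step_den C z" "9*C*z\<^sup>2 \<le> step_den C z"
proof -
  have "(39*C + 1) * z \<le> 0" "0 \<le> 9*C*z\<^sup>2"
    using assms by (auto intro: mult_nonneg_nonpos)
  then show "6 \<le> step_den C z" "9*C*z\<^sup>2 \<le> step_den C z"
    by (auto simp: step_den_def)
qed

lemma Q_eq: "Q C z = ((69*C - 1) * z\<^sup>2 + (16 - 960*C) * z + 3600*C - 48) /
                       (480 * stage_den z * step_den C z)"
  by (simp add: Q_def stage_den_def step_den_def)

section \<open>Exact error formula\<close>

lemma is_step_error:
  assumes step: "is_step C (rhs S l \<phi>) (rhs_dot S l \<phi>) dt t (\<phi> t) ys y1"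
    and "l \<le> 0" "dt > 0" "C > 0"
  shows "y1 - \<phi> (t + dt) =
    - deriv_within S 5 \<phi> t * dt^5 * Q C (l * dt) + dt^6 * error_rem C S \<phi> (l * dt) t dt"
proof -
  define z where "z = l * dt"
  define es where "es = ys - \<phi> (t + dt/2)"
  define e1 where "e1 = y1 - \<phi> (t + dt)"
  define P where "P = stage_den z"
  define D where "D = step_den C z"
  define A where "A = stage_defect S \<phi> t dt"
  define B where "B = step_defect C S \<phi> t dt"
  define q where "q = deriv_within S 5 \<phi> t * dt^5"
  have "z \<le> 0"
    using assms by (simp add: z_def mult_nonpos_nonneg)
  then have P: "P > 0" and D: "D > 0"
    using stage_den_bounds(1)[of z] step_den_bounds(1)[of z C] \<open>C > 0\<close> by (simp_all add: P_def D_def)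
  have ys: "ys = es + \<phi> (t + dt/2)" and y1: "y1 = e1 + \<phi> (t + dt)"
    by (auto simp: es_def e1_def)
  \<comment> \<open>An error \<open>e\<close> adds \<open>l * e\<close> to \<open>rhs\<close> and
    \<open>l^2 * e\<close> to \<open>rhs_dot\<close>; with the factors \<open>dt\<close> and
    \<open>dt^2\<close> these become \<open>z * e\<close> and \<open>z^2 * e\<close>. The starting
    error is zero.\<close>
  have "es * P = 48 * A"
    using step unfolding is_step_def rhs_def rhs_dot_def ys y1 A_def stage_defect_def P_def
      stage_den_def z_def
    by (simp add: algebra_simps power2_eq_square)
  then have es: "es = 48 * A / P"
    using P by (simp add: field_simps)
  have "e1 * D = 6 * (es * (a1 C * z - C * z\<^sup>2) + B)"
    using step unfolding is_step_def rhs_def rhs_dot_def ys y1 B_def step_defect_def D_def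
      step_den_def z_def a2_def
    by (simp add: algebra_simps power2_eq_square)
  then have e1: "e1 = 6 / D * (es * (a1 C * z - C * z\<^sup>2) + B)"
    using D by (simp add: field_simps)
  \<comment> \<open>Amplification factor with which the stage defect enters the final error.\<close>
  define w where "w = 48 * z * (a1 C - C*z) / P"
  have "es * (a1 C * z - C * z\<^sup>2) = w * A"
    by (simp add: es w_def algebra_simps power2_eq_square)
  with e1 have e1': "e1 = 6 / D * (w * A + B)"
    by simp
  have E: "dt^6 * error_rem C S \<phi> z t dt =
    6 / D * (w * (A + q/23040) + (B - (1 - 75*C) / 2880 * q))"
    using \<open>dt > 0\<close> 
    by (simp add: error_rem_def stage_rem_def step_rem_def A_def B_def D_def P_def q_def w_def)
  \<comment> \<open>Replacing \<open>A\<close> and \<open>B\<close> by their leading terms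
    \<open>- q/23040\<close> and \<open>(1 - 75*C)/2880 * q\<close> in \<open>e1'\<close> must leave
    \<open>- q * Q C z\<close>.\<close>
  have Q: "Q C z = - 6 / D * ((1 - 75*C) / 2880 - w / 23040)"
  proof -
    have "- 6 / D * ((1 - 75*C) / 2880 - w / 23040) =
        (6 * z * (a1 C - C*z) - (1 - 75*C) * P) / (480 * P * D)"
      using P D by (simp add: w_def divide_simps)
    also have "6 * z * (a1 C - C*z) - (1 - 75*C) * P =
        (69*C - 1) * z\<^sup>2 + (16 - 960*C) * z + 3600*C - 48"
      by (simp add: P_def stage_den_def a1_def algebra_simps power2_eq_square)
    finally show ?thesis
      by (simp add: Q_eq P_def D_def)
  qed
  have "e1 = - q * Q C z + dt^6 * error_rem C S \<phi> z t dt"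
    unfolding e1' E Q by (simp add: algebra_simps add_divide_distrib diff_divide_distrib)
  then show ?thesis
    by (simp add: e1_def q_def z_def)
qed

section \<open>Taylor bounds for the defects\<close>

lemma defect_remainder_bounds:
  assumes phi: "Ck_on 6 \<phi> S" and S: "{t..t + dt} \<subseteq> S" and "dt > 0"
    and M: "\<And>s. s \<in> {t..t + dt} \<Longrightarrow> \<bar>deriv_within S 6 \<phi> s\<bar> \<le> M"
  shows "\<bar>stage_rem S \<phi> t dt\<bar> \<le> 2 * (M * dt^6)"
    and "\<bar>step_rem C S \<phi> t dt\<bar> \<le> (1 + \<bar>a1 C\<bar> + \<bar>a2 C\<bar> + 3 * \<bar>C\<bar>) * (M * dt^6)"
proof -
  \<comment> \<open>The degree \<open>5 - k\<close> matches the order of the derivative, so that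
    weighting by \<open>dt^k\<close> gives order \<open>dt^6\<close> for every
    \<open>k\<close>.\<close>
  define r where
    "r k s =
       deriv_within S k \<phi> (t + s) - (\<Sum>i\<le>5-k. deriv_within S (k + i) \<phi> t * s^i / fact i)" for k s
  have M0: "M \<ge> 0"
    using M[of t] \<open>dt > 0\<close> by force
  have r: "dt^k * \<bar>r k s\<bar> \<le> M * dt^6" if "k \<le> 5" "0 \<le> s" "s \<le> dt" for k s
  proof -
    have [simp]: "Suc (k + (5 - k)) = 6"
      using that by simp
    have "\<bar>r k s\<bar> \<le> M * s^Suc (5 - k) / fact (5 - k)"
      using Ck_on_Taylor[of k "5 - k" \<phi> S t "t + dt" "t + s" M] phi S M that by (simp add: r_def)
    also have "\<dots> \<le> M * s^Suc (5 - k) / 1"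
      using M0 that by (intro divide_left_mono) (auto simp: fact_ge_1)
    also have "\<dots> \<le> M * dt^Suc (5 - k)"
      using M0 that by (simp only: div_by_1) (intro mult_left_mono power_mono; simp)
    finally have "dt^k * \<bar>r k s\<bar> \<le> dt^k * (M * dt^Suc (5 - k))"
      using \<open>dt > 0\<close> by (intro mult_left_mono) auto
    also have "\<dots> = M * (dt^k * dt^Suc (5 - k))"
      by (simp only: ac_simps)
    also have "dt^k * dt^Suc (5 - k) = dt^6"
      using that by (simp del: power_Suc flip: power_add)
    finally show ?thesis .
  qed
  define d where "d i = deriv_within S i \<phi> t" for i
  define u where "u = M * dt^6"
  have r0: "\<bar>r 0 s\<bar> \<le> u" and r1: "\<bar>dt * r 1 s\<bar> \<le> u" and r2: "\<bar>dt\<^sup>2 * r 2 s\<bar> \<le> u"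
    if "0 \<le> s" "s \<le> dt" for s
    using r[of 0 s] r[of 1 s] r[of 2 s] that \<open>dt > 0\<close> by (auto simp: abs_mult u_def)
  have half: "0 \<le> dt/2" "dt/2 \<le> dt" "0 \<le> dt"
    using \<open>dt > 0\<close> by auto
  have expand_0: "\<phi> (t + s) =
        r 0 s + (\<phi> t + d 1 * s + d 2 * s^2/2 + d 3 * s^3/6 + d 4 * s^4/24 + d 5 * s^5/120)"
    and expand_1: "d 1 + d 2 * s + d 3 * s^2/2 + d 4 * s^3/6 + d 5 * s^4/24 + r 1 s =
        deriv_within S 1 \<phi> (t + s)"
    and expand_2: "d 2 + d 3 * s + d 4 * s^2/2 + d 5 * s^3/6 + r 2 s =
        deriv_within S 2 \<phi> (t + s)" for s
    by (simp_all add: r_def d_def deriv_within_0 eval_nat_numeral)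
  \<comment> \<open>The Taylor polynomials cancel through order four. In order five they leave
    \<open>-1/3840 + 1/1536 - 1/2304 = -1/23040\<close>, which \<open>stage_rem\<close> adds
    back.\<close>
  have "stage_rem S \<phi> t dt = - r 0 (dt/2) + dt * r 1 (dt/2) / 4 - dt\<^sup>2 * r 2 (dt/2) / 48"
    unfolding stage_rem_def stage_defect_def expand_0 d_def[symmetric] expand_1[symmetric]
      expand_2[symmetric]
    by (simp add: power_divide algebra_simps power_numeral_reduce)
  then show "\<bar>stage_rem S \<phi> t dt\<bar> \<le> 2 * (M * dt^6)"
    using r0[of "dt/2"] r1[of "dt/2"] r2[of "dt/2"] half unfolding u_def[symmetric] by linarith
  \<comment> \<open>Here the fifth-order coefficient is
    \<open>-1/120 + a1 C/384 + a2 C/24 - C/48 - C/4 = (1 - 75*C)/2880\<close>; all lower orders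
    cancel by the choice of \<open>a0\<close>, \<open>a1\<close>, \<open>a2\<close>.\<close>
  have "step_rem C S \<phi> t dt = - r 0 dt + a1 C * (dt * r 1 (dt/2)) + a2 C * (dt * r 1 dt)
      - C * (dt\<^sup>2 * r 2 (dt/2)) - 3/2 * (C * (dt\<^sup>2 * r 2 dt))"
    unfolding step_rem_def step_defect_def expand_0 d_def[symmetric] expand_1[symmetric]
      expand_2[symmetric]
    by (simp add: a0_def a1_def a2_def power_divide algebra_simps add_divide_distrib
        diff_divide_distrib power_numeral_reduce)
  also have "\<bar>\<dots>\<bar> \<le> u + \<bar>a1 C\<bar> * u + \<bar>a2 C\<bar> * u + \<bar>C\<bar> * u + 3/2 * (\<bar>C\<bar> * u)"
  proof -
    have *: "\<bar>c * x\<bar> \<le> \<bar>c\<bar> * u" if "\<bar>x\<bar> \<le> u" for c x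
      using that by (simp add: abs_mult mult_left_mono)
    have **: "\<bar>3/2 * x\<bar> \<le> 3/2 * y" if "\<bar>x\<bar> \<le> y" for x y :: real
      using that by (simp add: abs_mult)
    show ?thesis
      using half
      by (intro abs_triangle_ineq[THEN order_trans] abs_triangle_ineq4[THEN order_trans]
          add_mono * ** r1 r2) (simp_all add: r0)
  qed
  \<comment> \<open>The total weight \<open>1 + 3/2\<close> of \<open>\<bar>C\<bar> * u\<close> is
    rounded up to 3.\<close>
  also have "\<dots> \<le> (1 + \<bar>a1 C\<bar> + \<bar>a2 C\<bar> + 3 * \<bar>C\<bar>) * u"
    using mult_nonneg_nonneg[of "\<bar>C\<bar>" u] M0 half by (simp add: u_def algebra_simps)
  finally show "\<bar>step_rem C S \<phi> t dt\<bar> \<le> (1 + \<bar>a1 C\<bar> + \<bar>a2 C\<bar> + 3 * \<bar>C\<bar>) * (M * dt^6)"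
    by (simp add: u_def)
qed

text \<open>Uniformity in \<open>z\<close> rests on two facts:
  \<open>6 / step_den C z \<le> 1\<close>, and the amplification factor of the stage defect is
  bounded because its numerator and denominator both have degree two.\<close>

lemma error_rem_bound:
  assumes "z \<le> 0" "C > 0" "dt > 0"
    and stage: "\<bar>stage_rem S \<phi> t dt\<bar> \<le> A * (M * dt^6)"
    and step: "\<bar>step_rem C S \<phi> t dt\<bar> \<le> B * (M * dt^6)"
  shows "\<bar>error_rem C S \<phi> z t dt\<bar> \<le> ((4 * \<bar>a1 C\<bar> + 48 * C) * A + B) * M"
proof -
  define u where "u = M * dt^6"
  define P where "P = stage_den z"
  define D where "D = step_den C z"
  define w where "w = 48 * z * (a1 C - C*z) / P"
  note P = stage_den_bounds[OF \<open>z \<le> 0\<close>, folded P_def]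
  have D: "D \<ge> 6"
    using step_den_bounds(1)[of z C] assms by (simp add: D_def)
  have "48 * z * (a1 C - C*z) = 48 * (z * a1 C) - 48 * C * z\<^sup>2"
    by (simp add: algebra_simps power2_eq_square)
  also have "\<bar>\<dots>\<bar> \<le> \<bar>48 * (z * a1 C)\<bar> + \<bar>48 * C * z\<^sup>2\<bar>"
    by (rule abs_triangle_ineq4)
  also have "\<dots> = 4 * \<bar>a1 C\<bar> * (12 * \<bar>z\<bar>) + 48 * C * z\<^sup>2"
    using \<open>C > 0\<close> by (simp add: abs_mult)
  \<comment> \<open>The linear part is absorbed by \<open>12 * \<bar>z\<bar> \<le> P\<close>, the
    quadratic part by \<open>z^2 \<le> P\<close>.\<close>
  also have "\<dots> \<le> 4 * \<bar>a1 C\<bar> * P + 48 * C * P"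
    using P \<open>C > 0\<close> by (intro add_mono mult_left_mono) auto
  finally have w: "\<bar>w\<bar> \<le> 4 * \<bar>a1 C\<bar> + 48 * C"
    using P by (simp add: w_def abs_divide divide_le_eq algebra_simps)
  have "\<bar>error_rem C S \<phi> z t dt\<bar> = 6 / D * \<bar>w * stage_rem S \<phi> t dt + step_rem C S \<phi> t dt\<bar> / dt^6"
    unfolding error_rem_def D_def[symmetric] P_def[symmetric] w_def[symmetric] abs_mult abs_divide
    using D \<open>dt > 0\<close> by simp
  also have "\<dots> \<le> 1 * ((4 * \<bar>a1 C\<bar> + 48 * C) * (A * u) + B * u) / dt^6"
  proof (intro divide_right_mono mult_mono)
    have "\<bar>w * stage_rem S \<phi> t dt\<bar> \<le> (4 * \<bar>a1 C\<bar> + 48 * C) * (A * u)"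
      unfolding abs_mult using w stage by (intro mult_mono) (auto simp: u_def)
    then show "\<bar>w * stage_rem S \<phi> t dt + step_rem C S \<phi> t dt\<bar>
        \<le> (4 * \<bar>a1 C\<bar> + 48 * C) * (A * u) + B * u"
      using step by (simp add: u_def)
  qed (use D \<open>dt > 0\<close> in auto)
  also have "\<dots> = ((4 * \<bar>a1 C\<bar> + 48 * C) * A + B) * M"
    using \<open>dt > 0\<close> by (simp add: u_def field_simps)
  finally show ?thesis .
qed

section \<open>Behaviour of \<open>Q\<close> in the stiff limit\<close>

lemma Q_asymptotics:
  assumes "C > 0"
  shows "(\<lambda>z. Q C z - (69*C - 1) / (4320*C) * z powi (-2)) \<in> O[at_bot](\<lambda>z. z powi (-3))"
proof -
  \<comment> \<open>Ratio of the leading coefficients of numerator and denominator, as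
    \<open>480 * 9 = 4320\<close>. Over a common denominator the \<open>z^4\<close> terms then
    cancel, and \<open>p0\<close> to \<open>p3\<close> are the coefficients of the remaining
    cubic.\<close>
  define c where "c = (69*C - 1) / (4320*C)"
  define p0 where "p0 = - (480*48*6) * c"
  define p1 where "p1 = 480 * c * (48 * (39*C + 1) + 72)"
  define p2 where "p2 = 3600*C - 48 - 480 * c * (6 + 12 * (39*C + 1) + 432*C)"
  define p3 where "p3 = 16 - 960*C + 480 * c * (39*C + 1 + 108*C)"
  define A where "A = \<bar>p0\<bar> + \<bar>p1\<bar> + \<bar>p2\<bar> + \<bar>p3\<bar>"
  have "norm (Q C z - c * z powi (-2)) \<le> A / (4320*C) * norm (z powi (-3))" if z: "z \<le> -1" for z
  proof -
    define R where "R = 480 * stage_den z * step_den C z"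
    have R: "4320*C * z^4 \<le> R"
    proof -
      have "z\<^sup>2 * (9*C*z\<^sup>2) \<le> stage_den z * step_den C z"
        using stage_den_bounds[of z] step_den_bounds[of z C] assms z by (intro mult_mono) auto
      also have "z\<^sup>2 * (9*C*z\<^sup>2) = 9*C * z^4"
        by algebra
      finally show ?thesis
        by (simp add: R_def)
    qed
    have z4: "0 < 4320*C * z^4"
      using z assms by simp
    have "Q C z - c * z powi (-2) =
        (((69*C - 1) * z\<^sup>2 + (16 - 960*C) * z + 3600*C - 48) * z\<^sup>2 - c * R) / (R * z\<^sup>2)"
      using R z4 z by (simp add: Q_eq power_int_minus divide_simps flip: R_def)
    also have "((69*C - 1) * z\<^sup>2 + (16 - 960*C) * z + 3600*C - 48) * z\<^sup>2 - c * R =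
        p0 + p1 * z + p2 * z^2 + p3 * z^3"
    proof -
      have "69*C - 1 = 4320 * C * c"
        using assms by (simp add: c_def)
      then show ?thesis
        unfolding R_def p0_def p1_def p2_def p3_def stage_den_def step_den_def
        by algebra
    qed
    finally have "norm (Q C z - c * z powi (-2)) = \<bar>p0 + p1 * z + p2 * z^2 + p3 * z^3\<bar> / (R * z\<^sup>2)"
      using R z4 by (simp add: abs_divide abs_mult)
    also have "\<dots> \<le> (A * \<bar>z\<bar>^3) / (4320*C * z^4 * z\<^sup>2)"
    proof (intro frac_le)
      \<comment> \<open>This is where \<open>z \<le> -1\<close> matters: every lower power is at
        most \<open>\<bar>z\<bar>^3\<close>.\<close>
      have *: "\<bar>p * z^i\<bar> \<le> \<bar>p\<bar> * \<bar>z\<bar>^3" if "i \<le> 3" for p i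
        unfolding abs_mult power_abs using that z by (intro mult_left_mono power_increasing) auto
      show "\<bar>p0 + p1 * z + p2 * z^2 + p3 * z^3\<bar> \<le> A * \<bar>z\<bar>^3"
        unfolding A_def distrib_right
        using *[of 0 p0] *[of 1 p1] *[of 2 p2] *[of 3 p3]
        by (intro abs_triangle_ineq[THEN order_trans] add_mono) auto
      show "0 \<le> A * \<bar>z\<bar>^3"
        by (intro mult_nonneg_nonneg) (auto simp: A_def)
    qed (use R z4 z in auto)
    also have "\<dots> = A * \<bar>z\<bar>^3 / (4320*C * (\<bar>z\<bar>^3 * \<bar>z\<bar>^3))"
      by (simp add: mult.assoc flip: power_add)
    also have "\<dots> = A / (4320*C) * norm (z powi (-3))"
      using z assms by (simp add: power_int_minus power_abs divide_simps del: abs_of_nonpos abs_of_neg)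
    finally show ?thesis .
  qed
  then show ?thesis
    unfolding c_def[symmetric]
    by (intro bigoI[of _ "A / (4320*C)"] eventually_at_bot_linorderI[of "-1"]) auto
qed

theorem proposition2:
  fixes C :: real
  assumes "C \<in> {C_minus..C_plus}"
  shows
    "(\<exists>K::real. \<forall>(T::real) (\<phi>::real \<Rightarrow> real). Ck_on 6 \<phi> {0..T} \<longrightarrow>
       (\<exists>E :: real \<Rightarrow> real \<Rightarrow> real \<Rightarrow> real.
          (\<forall>l dt t ys y1. l < 0 \<longrightarrow> dt > 0 \<longrightarrow> {t..t + dt} \<subseteq> {0..T} \<longrightarrow>
             is_step C (rhs {0..T} l \<phi>) (rhs_dot {0..T} l \<phi>) dt t (\<phi> t) ys y1 \<longrightarrow>
             y1 - \<phi> (t + dt) =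
               - deriv_within {0..T} 5 \<phi> t * dt^5 * Q C (l * dt) + dt^6 * E (l * dt) t dt) \<and>
          (\<forall>z dt t. z \<le> 0 \<longrightarrow> dt > 0 \<longrightarrow> {t..t + dt} \<subseteq> {0..T} \<longrightarrow>
             \<bar>E z t dt\<bar> \<le> K * (SUP s\<in>{t..t + dt}. \<bar>deriv_within {0..T} 6 \<phi> s\<bar>)))) \<and>
     (\<lambda>z. Q C z - (69*C - 1) / (4320*C) * z powi (-2)) \<in> O[at_bot](\<lambda>z. z powi (-3))"
proof
  have C: "C > 0"
    using assms C_minus_pos by auto
  \<comment> \<open>\<open>error_rem_bound\<close> with the constants of
    \<open>defect_remainder_bounds\<close>. Only \<open>C\<close> occurs, so \<open>K\<close> can be
    chosen before \<open>T\<close> and \<open>\<phi>\<close>.\<close>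
  define K where "K = (4 * \<bar>a1 C\<bar> + 48 * C) * 2 + (1 + \<bar>a1 C\<bar> + \<bar>a2 C\<bar> + 3 * \<bar>C\<bar>)"
  have "\<bar>error_rem C {0..T} \<phi> z t dt\<bar> \<le> K * (SUP s\<in>{t..t + dt}. \<bar>deriv_within {0..T} 6 \<phi> s\<bar>)"
    if "Ck_on 6 \<phi> {0..T}" "z \<le> 0" "dt > 0" "{t..t + dt} \<subseteq> {0..T}" for T \<phi> z t dt
  proof -
    have "\<bar>deriv_within {0..T} 6 \<phi> s\<bar> \<le> (SUP s\<in>{t..t + dt}. \<bar>deriv_within {0..T} 6 \<phi> s\<bar>)"
      if "s \<in> {t..t + dt}" for s
      using that Ck_on_bdd_above[OF \<open>Ck_on 6 \<phi> {0..T}\<close> \<open>{t..t + dt} \<subseteq> {0..T}\<close>]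
      by (intro cSUP_upper)
    note bounds = defect_remainder_bounds[OF that(1) that(4) that(3) this]
    show ?thesis
      unfolding K_def by (rule error_rem_bound[OF that(2) C that(3) _ bounds(2)]) (use bounds(1) in simp)
  qed
  then show "\<exists>K::real. \<forall>(T::real) (\<phi>::real \<Rightarrow> real). Ck_on 6 \<phi> {0..T} \<longrightarrow>
       (\<exists>E :: real \<Rightarrow> real \<Rightarrow> real \<Rightarrow> real.
          (\<forall>l dt t ys y1. l < 0 \<longrightarrow> dt > 0 \<longrightarrow> {t..t + dt} \<subseteq> {0..T} \<longrightarrow>
             is_step C (rhs {0..T} l \<phi>) (rhs_dot {0..T} l \<phi>) dt t (\<phi> t) ys y1 \<longrightarrow>
             y1 - \<phi> (t + dt) =
               - deriv_within {0..T} 5 \<phi> t * dt^5 * Q C (l * dt) + dt^6 * E (l * dt) t dt) \<and>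
          (\<forall>z dt t. z \<le> 0 \<longrightarrow> dt > 0 \<longrightarrow> {t..t + dt} \<subseteq> {0..T} \<longrightarrow>
             \<bar>E z t dt\<bar> \<le> K * (SUP s\<in>{t..t + dt}. \<bar>deriv_within {0..T} 6 \<phi> s\<bar>)))"
    using is_step_error C
    by (intro exI[of _ K] allI impI, rule_tac x = "error_rem C {0..T} \<phi>" in exI)
      (auto simp: less_imp_le)
  show "(\<lambda>z. Q C z - (69*C - 1) / (4320*C) * z powi (-2)) \<in> O[at_bot](\<lambda>z. z powi (-3))"
    using C by (rule Q_asymptotics)
qed

end
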